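(* Let $C$ be a nonempty closed convex subset of a real Hilbert space $\mathcal{H}$ and let $T:C\to C$ be a nonexpansive mapping with $Fix(T)\neq\emptyset$. Let $x^0\in C$, $u\in C$, let $\{\lambda_k\}_{k\ge1}\subset(0,1)$, and let $\{x^k\}_{k\ge 1}$ be generated by $$x^k=\lambda_k u+(1-\lambda_k)Tx^{k-1},\qquad k\ge 1.$$ Assume $\lambda_k\to 0$ and $x^k\to q$ in norm as $k\to\infty$. (i) For each $z\in\mathcal{H}$, $$\lim_{k\to\infty}\frac{\|x^k-z\|^2-\|Tx^{k-1}-z\|^2}{\lambda_k}=2\langle u-q,\,q-z\rangle.$$ (ii) Set $$H_0=\left\{z\in\mathcal{H}:\lim_{k\to\infty}\frac{\|x^k-z\|^2-\|Tx^{k-1}-z\|^2}{\lambda_k}=0\right\},\qquad H_+=\left\{z\in\mathcal{H}:\lim_{k\to\infty}\frac{\|x^k-z\|^2-\|Tx^{k-1}-z\|^2}{\lambda_k}\ge 0\right\}.$$ Then $$q=P_{H_0\cap C}u=P_{H_+\cap Fix(T)}u.$$ (iii) If, in addition, $\sum_{k=1}^\infty\lambda_k=\infty$, then $q=P_{H_0\cap C}u=P_{Fix(T)}u$.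
   Context: A mapping $T:C\to C$ is nonexpansive if $\|Tx-Ty\|\le\|x-y\|$ for all $x,y\in C$. $Fix(T)=\{x\in C: Tx=x\}$. For a nonempty closed convex set $D\subset\mathcal{H}$, $P_D$ denotes the metric (nearest point) projection onto $D$: $P_D(x)=\arg\min\{\|x-y\|: y\in D\}$. *)

theory Defs
  imports "HOL-Analysis.Analysis"
begin

definition fix_set :: "'a set \<Rightarrow> ('a \<Rightarrow> 'a) \<Rightarrow> 'a set" where
  "fix_set C T = {x \<in> C. T x = x}"

(* The library's closest_point lives in heine_borel spaces, hence only in finite dimension.
   Here the minimizer exists and is unique whenever D is a nonempty closed convex subset of a
   Hilbert space; the value is meaningful only for such D. *)
definition metric_proj :: "'a::real_normed_vector set \<Rightarrow> 'a \<Rightarrow> 'a" where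
  "metric_proj D x = arg_min_on (\<lambda>y. norm (x - y)) D"

(* Only the values at k \<ge> 1 are meaningful; k = 0 is irrelevant for limits. *)
definition halpern_quot ::
  "('a::real_normed_vector \<Rightarrow> 'a) \<Rightarrow> (nat \<Rightarrow> real) \<Rightarrow> (nat \<Rightarrow> 'a) \<Rightarrow> 'a \<Rightarrow> nat \<Rightarrow> real" where
  "halpern_quot T lam x z k =
     ((norm (x k - z))\<^sup>2 - (norm (T (x (k - 1)) - z))\<^sup>2) / lam k"

definition H_zero ::
  "('a::real_normed_vector \<Rightarrow> 'a) \<Rightarrow> (nat \<Rightarrow> real) \<Rightarrow> (nat \<Rightarrow> 'a) \<Rightarrow> 'a set" where
  "H_zero T lam x = {z. halpern_quot T lam x z \<longlonglongrightarrow> 0}"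

definition H_plus ::
  "('a::real_normed_vector \<Rightarrow> 'a) \<Rightarrow> (nat \<Rightarrow> real) \<Rightarrow> (nat \<Rightarrow> 'a) \<Rightarrow> 'a set" where
  "H_plus T lam x = {z. \<exists>L\<ge>0. halpern_quot T lam x z \<longlonglongrightarrow> L}"

end

theory Submission
  imports Defs
begin

text \<open>
  Since $x^k - Tx^{k-1} = \lambda_k (u - Tx^{k-1})$, the difference quotient equals
  $\langle u - Tx^{k-1},\, x^k + Tx^{k-1} - 2z\rangle$, which tends to
  $2\langle u-q, q-z\rangle$. Hence, for $u \ne q$, $H_0$ is the hyperplane through $q$ orthogonal to $u-q$ and $H_+$
  is the half-space behind it, as seen from $u$, and $q$ is the nearest point to $u$ of any of their
  subsets containing $q$. If $z$ is a fixed point outside $H_+$, then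
  $\|x^k-z\|^2 \le \|x^{k-1}-z\|^2 - c\lambda_k$ eventually for some $c>0$, so
  $\sum\lambda_k$ converges.
\<close>

text \<open>Obtuse-angle criterion: expanding the square about \<open>q\<close> leaves a nonnegative
  cross term, so moving from \<open>q\<close> to \<open>y\<close> costs at least
  \<open>(norm (q - y))\<^sup>2\<close>. This gives minimality of \<open>q\<close> and uniqueness at
  once.\<close>

lemma metric_proj_eqI:
  fixes u q :: "'a::real_inner"
  assumes "q \<in> D" and obtuse: "\<And>y. y \<in> D \<Longrightarrow> (u - q) \<bullet> (q - y) \<ge> 0"
  shows "metric_proj D u = q"
proof -
  have pyth: "(norm (u - q))\<^sup>2 + (norm (q - y))\<^sup>2 \<le> (norm (u - y))\<^sup>2" if "y \<in> D" for y
  proof -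
    have "(norm (u - y))\<^sup>2 = (norm (u - q))\<^sup>2 + (norm (q - y))\<^sup>2 + 2 * ((u - q) \<bullet> (q - y))"
      by (simp add: power2_norm_eq_inner inner_diff_left inner_diff_right inner_commute)
    then show ?thesis
      using obtuse[OF that] by simp
  qed
  have min: "norm (u - q) \<le> norm (u - y)" if "y \<in> D" for y
  proof (rule power2_le_imp_le)
    show "(norm (u - q))\<^sup>2 \<le> (norm (u - y))\<^sup>2"
      using pyth[OF that] zero_le_power2[of "norm (q - y)"] by linarith
  qed simp
  have "is_arg_min (\<lambda>y. norm (u - y)) (\<lambda>y. y \<in> D) q"
    using \<open>q \<in> D\<close> min by (auto simp: is_arg_min_linorder)
  \<comment> \<open>The projection is a Hilbert choice, so the existence of a minimizer shows only
    that it is some minimizer; the surplus term in \<open>pyth\<close> then forces it to coincide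
    with \<open>q\<close>.\<close>
  then have "is_arg_min (\<lambda>y. norm (u - y)) (\<lambda>y. y \<in> D) (metric_proj D u)"
    unfolding metric_proj_def arg_min_on_def arg_min_def by (rule someI)
  then have p: "metric_proj D u \<in> D" "norm (u - metric_proj D u) \<le> norm (u - q)"
    using \<open>q \<in> D\<close> by (auto simp: is_arg_min_linorder)
  have "(norm (u - metric_proj D u))\<^sup>2 \<le> (norm (u - q))\<^sup>2"
    using p(2) by (intro power_mono) auto
  then have "(norm (q - metric_proj D u))\<^sup>2 \<le> 0"
    using pyth[OF p(1)] by linarith
  then show ?thesis
    by simp
qed

text \<open>Stewart's identity. It replaces a strict convexity argument in the proof that the fixed
  points form a convex set.\<close>

lemma norm_convex_combination_power2:
  fixes a b w :: "'a::real_inner"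
  assumes "s + t = 1"
  shows "(norm (s *\<^sub>R a + t *\<^sub>R b - w))\<^sup>2
    = s * (norm (a - w))\<^sup>2 + t * (norm (b - w))\<^sup>2 - s * t * (norm (a - b))\<^sup>2"
proof -
  define v where "v = a - w"
  define v' where "v' = b - w"
  have s: "s = 1 - t"
    using assms by simp
  have "s *\<^sub>R a + t *\<^sub>R b - w = s *\<^sub>R v + t *\<^sub>R v'" "a - b = v - v'"
    by (simp_all add: s v_def v'_def algebra_simps)
  moreover have "(norm (s *\<^sub>R v + t *\<^sub>R v'))\<^sup>2
      = s * (norm v)\<^sup>2 + t * (norm v')\<^sup>2 - s * t * (norm (v - v'))\<^sup>2"
    unfolding power2_norm_eq_inner s
    by (simp add: inner_diff_left inner_diff_right inner_add_left inner_add_right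
        inner_commute[of v' v]) (simp add: algebra_simps)
  ultimately show ?thesis
    by (simp only: v_def v'_def)
qed

text \<open>For \<open>z\<close> on the segment between fixed points \<open>a\<close> and
  \<open>b\<close>, nonexpansiveness puts \<open>T z\<close> no farther from either endpoint than
  \<open>z\<close>. Comparing Stewart's identity at \<open>w = T z\<close> and at
  \<open>w = z\<close> bounds the squared distance from \<open>z\<close> to \<open>T z\<close> by
  0.\<close>

lemma convex_fix_set:
  fixes C :: "'a::real_inner set"
  assumes "convex C" and lip: "1-lipschitz_on C T"
  shows "convex (fix_set C T)"
proof (rule convexI)
  fix a b :: 'a and s t :: real
  assume a: "a \<in> fix_set C T" and b: "b \<in> fix_set C T" and st: "0 \<le> s" "0 \<le> t" "s + t = 1"
  define z where "z = s *\<^sub>R a + t *\<^sub>R b"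
  have z: "z \<in> C"
    using a b st \<open>convex C\<close> by (auto simp: z_def fix_set_def convex_def)
  have le: "(norm (p - T z))\<^sup>2 \<le> (norm (p - z))\<^sup>2" if "p \<in> fix_set C T" for p
    using lipschitz_onD[OF lip, of p z] that z by (auto simp: fix_set_def dist_norm)
  have "(norm (z - T z))\<^sup>2
      = s * (norm (a - T z))\<^sup>2 + t * (norm (b - T z))\<^sup>2 - s * t * (norm (a - b))\<^sup>2"
    unfolding z_def by (rule norm_convex_combination_power2[OF st(3)])
  also have "\<dots> \<le> s * (norm (a - z))\<^sup>2 + t * (norm (b - z))\<^sup>2 - s * t * (norm (a - b))\<^sup>2"
    using le[OF a] le[OF b] st by (intro diff_mono add_mono mult_left_mono) auto
  also have "\<dots> = (norm (z - z))\<^sup>2"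
    using norm_convex_combination_power2[OF st(3), of a b z] by (simp add: z_def)
  finally have "T z = z"
    by simp
  then show "s *\<^sub>R a + t *\<^sub>R b \<in> fix_set C T"
    using z by (simp add: fix_set_def z_def)
qed

lemma closed_fix_set:
  fixes C :: "'a::metric_space set"
  assumes "closed C" and lip: "L-lipschitz_on C T"
  shows "closed (fix_set C T)"
proof -
  have "continuous_on C (\<lambda>z. dist (T z) z)"
    using lipschitz_on_continuous_on[OF lip] by (intro continuous_intros)
  then have "closed {z \<in> C. dist (T z) z = 0}"
    by (rule continuous_closed_preimage_constant[OF _ \<open>closed C\<close>])
  then show ?thesis
    by (simp add: fix_set_def)
qed

lemma halpern_quot_tendsto:
  fixes x :: "nat \<Rightarrow> 'a::real_inner"
  assumes lam: "\<And>k. k \<ge> 1 \<Longrightarrow> lam k \<noteq> 0"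
    and rec: "\<And>k. k \<ge> 1 \<Longrightarrow> x k = lam k *\<^sub>R u + (1 - lam k) *\<^sub>R T (x (k - 1))"
    and "x \<longlonglongrightarrow> q" and T_lim: "(\<lambda>k. T (x (k - 1))) \<longlonglongrightarrow> q"
  shows "halpern_quot T lam x z \<longlonglongrightarrow> 2 * ((u - q) \<bullet> (q - z))"
proof -
  have "halpern_quot T lam x z k
      = (u - T (x (k - 1))) \<bullet> (x k + T (x (k - 1)) - 2 *\<^sub>R z)" if "k \<ge> 1" for k
  proof -
    define v where "v = T (x (k - 1))"
    have step: "x k - v = lam k *\<^sub>R (u - v)"
      using rec[OF that] by (simp add: v_def algebra_simps)
    \<comment> \<open>Difference of squares, with \<open>z\<close> cancelling in the first factor;
      that factor carries the \<open>lam k\<close> which removes the denominator.\<close>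
    have "(norm (x k - z))\<^sup>2 - (norm (v - z))\<^sup>2 = (x k - v) \<bullet> (x k + v - 2 *\<^sub>R z)"
      by (simp add: power2_norm_eq_inner inner_diff_left inner_diff_right inner_add_right
          inner_commute)
    also have "\<dots> = lam k * ((u - v) \<bullet> (x k + v - 2 *\<^sub>R z))"
      unfolding step by simp
    finally show ?thesis
      using lam[OF that] by (simp add: halpern_quot_def v_def)
  qed
  then have "eventually (\<lambda>k. (u - T (x (k - 1))) \<bullet> (x k + T (x (k - 1)) - 2 *\<^sub>R z)
      = halpern_quot T lam x z k) sequentially"
    by (auto intro: eventually_sequentiallyI[of 1])
  moreover have "(\<lambda>k. (u - T (x (k - 1))) \<bullet> (x k + T (x (k - 1)) - 2 *\<^sub>R z))
      \<longlonglongrightarrow> (u - q) \<bullet> (q + q - 2 *\<^sub>R z)"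
    by (intro tendsto_intros assms)
  moreover have "(u - q) \<bullet> (q + q - 2 *\<^sub>R z) = 2 * ((u - q) \<bullet> (q - z))"
    by (simp add: inner_diff_right inner_add_right)
  ultimately show ?thesis
    by (simp add: Lim_transform_eventually)
qed

text \<open>Telescoping: from \<open>N\<close> on, \<open>c\<close> times the partial sum plus
  \<open>a n\<close> never increases, and \<open>a n\<close> is bounded below by 0.\<close>

lemma sum_not_at_top_if_eventually_decreasing:
  fixes a lam :: "nat \<Rightarrow> real"
  assumes nonneg: "\<And>k. a k \<ge> 0" and "c > 0"
    and dec: "\<And>k. k \<ge> N \<Longrightarrow> a (Suc k) \<le> a k - c * lam (Suc k)"
  shows "\<not> filterlim (\<lambda>n. \<Sum>k=1..n. lam k) at_top sequentially"
proof
  assume lim: "filterlim (\<lambda>n. \<Sum>k=1..n. lam k) at_top sequentially"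
  have bound: "c * (\<Sum>k=1..n. lam k) + a n \<le> c * (\<Sum>k=1..N. lam k) + a N" if "n \<ge> N" for n
    using that
  proof (induction rule: dec_induct)
    case (step n)
    then show ?case
      using dec[of n] by (simp add: algebra_simps)
  qed simp
  define B where "B = (c * (\<Sum>k=1..N. lam k) + a N) / c"
  have "eventually (\<lambda>n. B < (\<Sum>k=1..n. lam k)) sequentially"
    using lim by (simp add: filterlim_at_top_dense)
  then obtain n where "n \<ge> N" "B < (\<Sum>k=1..n. lam k)"
    using eventually_happens'[OF _ eventually_conj[OF eventually_ge_at_top[of N]]] by force
  then show False
    using bound[of n] nonneg[of n] \<open>c > 0\<close> by (simp add: B_def field_simps)
qed

text \<open>This places every fixed point in \<open>H_plus\<close> when the weights have a divergent
  sum. A negative limit would make the squared distance to \<open>z\<close> drop by a fixed multiple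
  of \<open>lam\<close> at each late step.\<close>

lemma halpern_quot_limit_nonneg:
  fixes x :: "nat \<Rightarrow> 'a::real_normed_vector"
  assumes lip: "1-lipschitz_on C T" and xC: "\<And>k. x k \<in> C" and z: "z \<in> fix_set C T"
    and lam: "\<And>k. k \<ge> 1 \<Longrightarrow> lam k > 0"
    and lim: "halpern_quot T lam x z \<longlonglongrightarrow> L"
    and div: "filterlim (\<lambda>n. \<Sum>k=1..n. lam k) at_top sequentially"
  shows "L \<ge> 0"
proof (rule ccontr)
  assume "\<not> L \<ge> 0"
  then have "eventually (\<lambda>k. halpern_quot T lam x z k < L / 2) sequentially"
    using lim by (intro order_tendstoD(2)[OF lim]) auto
  then obtain N where N: "\<And>k. k \<ge> N \<Longrightarrow> halpern_quot T lam x z k < L / 2"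
    by (auto simp: eventually_sequentially)
  \<comment> \<open>Bounding the quotient by \<open>L / 2\<close> rather than \<open>L\<close>
    leaves room for convergence; the decrease constant is therefore \<open>- L / 2\<close>.\<close>
  have "(norm (x (Suc k) - z))\<^sup>2 \<le> (norm (x k - z))\<^sup>2 - (- L / 2) * lam (Suc k)"
    if "k \<ge> N" for k
  proof -
    have "(norm (x (Suc k) - z))\<^sup>2 - (norm (T (x k) - z))\<^sup>2 < L / 2 * lam (Suc k)"
      using N[of "Suc k"] that lam[of "Suc k"]
      by (simp add: halpern_quot_def pos_divide_less_eq del: of_nat_Suc)
    moreover have "norm (T (x k) - z) \<le> norm (x k - z)"
      using lipschitz_onD[OF lip xC, of z k] z by (auto simp: fix_set_def dist_norm)
    then have "(norm (T (x k) - z))\<^sup>2 \<le> (norm (x k - z))\<^sup>2"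
      by (intro power_mono) auto
    ultimately show ?thesis
      by linarith
  qed
  then show False
    using sum_not_at_top_if_eventually_decreasing[of "\<lambda>k. (norm (x k - z))\<^sup>2" "- L / 2" N lam]
      \<open>\<not> L \<ge> 0\<close> div by simp
qed

theorem theorem4p1:
  fixes C :: "'a::{real_inner, complete_space} set"
    and T :: "'a \<Rightarrow> 'a"
    and u q :: 'a
    and lam :: "nat \<Rightarrow> real"
    and x :: "nat \<Rightarrow> 'a"
  assumes "C \<noteq> {}" and "closed C" and "convex C"
    and "T \<in> C \<rightarrow> C" and "1-lipschitz_on C T"
    and "fix_set C T \<noteq> {}"
    and "x 0 \<in> C" and "u \<in> C"
    and "\<And>k. k \<ge> 1 \<Longrightarrow> 0 < lam k \<and> lam k < 1"
    and "\<And>k. k \<ge> 1 \<Longrightarrow> x k = lam k *\<^sub>R u + (1 - lam k) *\<^sub>R T (x (k - 1))"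
    and "lam \<longlonglongrightarrow> 0" and "x \<longlonglongrightarrow> q"
  shows "(\<forall>z. halpern_quot T lam x z \<longlonglongrightarrow> 2 * ((u - q) \<bullet> (q - z)))
    \<and> ((\<forall>D \<in> {H_zero T lam x \<inter> C, H_plus T lam x \<inter> fix_set C T}.
           D \<noteq> {} \<and> closed D \<and> convex D)
       \<and> q = metric_proj (H_zero T lam x \<inter> C) u
       \<and> q = metric_proj (H_plus T lam x \<inter> fix_set C T) u)
    \<and> (filterlim (\<lambda>n. \<Sum>k=1..n. lam k) at_top sequentially \<longrightarrow>
         (closed (fix_set C T) \<and> convex (fix_set C T))
         \<and> q = metric_proj (H_zero T lam x \<inter> C) u
         \<and> q = metric_proj (fix_set C T) u)"
proof -
  note lam = assms(9) and rec = assms(10)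
  have x_C: "x k \<in> C" for k
  proof (induction k)
    case (Suc k)
    then show ?case
      using rec[of "Suc k"] lam[of "Suc k"] \<open>u \<in> C\<close> \<open>T \<in> C \<rightarrow> C\<close>
        convexD[OF \<open>convex C\<close>, of u "T (x k)" "lam (Suc k)" "1 - lam (Suc k)"]
      by auto
  qed (fact \<open>x 0 \<in> C\<close>)
  have "q \<in> C"
    using closed_sequentially[OF \<open>closed C\<close> _ \<open>x \<longlonglongrightarrow> q\<close>] x_C by blast
  have T_lim_Tq: "(\<lambda>k. T (x k)) \<longlonglongrightarrow> T q"
    using continuous_on_tendsto_compose[OF lipschitz_on_continuous_on[OF assms(5)]
        \<open>x \<longlonglongrightarrow> q\<close> \<open>q \<in> C\<close>] x_C by simp
  \<comment> \<open>As the weight of \<open>u\<close> vanishes, the recursion sends the iterates to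
    \<open>T q\<close>; uniqueness of limits makes \<open>q\<close> a fixed point.\<close>
  have "(\<lambda>k. lam (Suc k) *\<^sub>R u + (1 - lam (Suc k)) *\<^sub>R T (x k)) \<longlonglongrightarrow> 0 *\<^sub>R u + (1 - 0) *\<^sub>R T q"
    by (intro tendsto_intros T_lim_Tq LIMSEQ_Suc[OF \<open>lam \<longlonglongrightarrow> 0\<close>])
  moreover have "(\<lambda>k. lam (Suc k) *\<^sub>R u + (1 - lam (Suc k)) *\<^sub>R T (x k)) = (\<lambda>k. x (Suc k))"
    using rec[of "Suc k" for k] by simp
  ultimately have "(\<lambda>k. x (Suc k)) \<longlonglongrightarrow> T q"
    by simp
  then have "T q = q"
    using LIMSEQ_Suc[OF \<open>x \<longlonglongrightarrow> q\<close>] by (rule LIMSEQ_unique)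
  have "(\<lambda>k. T (x (k - 1))) \<longlonglongrightarrow> q"
    using T_lim_Tq \<open>T q = q\<close> by (subst filterlim_sequentially_Suc[symmetric]) simp
  then have quot_lim: "halpern_quot T lam x z \<longlonglongrightarrow> 2 * ((u - q) \<bullet> (q - z))" for z
    by (intro halpern_quot_tendsto rec \<open>x \<longlonglongrightarrow> q\<close>) (use lam in force)
  \<comment> \<open>The limit exists for every \<open>z\<close>, so membership depends only on its
    value. For \<open>u = q\<close> this set and \<open>H_plus\<close> are the whole space.\<close>
  have H_zero_eq: "H_zero T lam x = {z. (u - q) \<bullet> z = (u - q) \<bullet> q}"
  proof (rule set_eqI, unfold mem_Collect_eq)
    fix z
    have "z \<in> H_zero T lam x \<longleftrightarrow> 2 * ((u - q) \<bullet> (q - z)) = 0"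
      using quot_lim[of z] LIMSEQ_unique[OF quot_lim[of z], of 0]
      unfolding H_zero_def mem_Collect_eq by metis
    also have "\<dots> \<longleftrightarrow> (u - q) \<bullet> z = (u - q) \<bullet> q"
      unfolding inner_diff_right[of "u - q" q z] by auto
    finally show "z \<in> H_zero T lam x \<longleftrightarrow> (u - q) \<bullet> z = (u - q) \<bullet> q" .
  qed
  have H_plus_eq: "H_plus T lam x = {z. (u - q) \<bullet> z \<le> (u - q) \<bullet> q}"
  proof (rule set_eqI, unfold mem_Collect_eq)
    fix z
    have "z \<in> H_plus T lam x \<longleftrightarrow> 2 * ((u - q) \<bullet> (q - z)) \<ge> 0"
      using quot_lim[of z] LIMSEQ_unique[OF quot_lim[of z]]
      unfolding H_plus_def mem_Collect_eq by blast
    also have "\<dots> \<longleftrightarrow> (u - q) \<bullet> z \<le> (u - q) \<bullet> q"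
      unfolding inner_diff_right[of "u - q" q z] by auto
    finally show "z \<in> H_plus T lam x \<longleftrightarrow> (u - q) \<bullet> z \<le> (u - q) \<bullet> q" .
  qed
  have q_fix: "q \<in> fix_set C T"
    using \<open>q \<in> C\<close> \<open>T q = q\<close> by (simp add: fix_set_def)
  have fix_cc: "closed (fix_set C T)" "convex (fix_set C T)"
    using closed_fix_set convex_fix_set assms by blast+
  have D: "D \<noteq> {} \<and> closed D \<and> convex D"
    if "D \<in> {H_zero T lam x \<inter> C, H_plus T lam x \<inter> fix_set C T}" for D
    using that \<open>q \<in> C\<close> q_fix fix_cc \<open>closed C\<close> \<open>convex C\<close>
    by (auto simp: H_zero_eq H_plus_eq intro!: closed_Int convex_Int closed_hyperplane
        convex_hyperplane closed_halfspace_le convex_halfspace_le)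
  \<comment> \<open>On the hyperplane the obtuse-angle condition holds with equality; on the
    half-space, treated next, it is the defining inequality.\<close>
  have proj_zero: "q = metric_proj (H_zero T lam x \<inter> C) u"
    using \<open>q \<in> C\<close>
    by (intro metric_proj_eqI[symmetric]) (simp_all add: H_zero_eq inner_diff_right[of _ q])
  have proj_plus: "q = metric_proj (H_plus T lam x \<inter> fix_set C T) u"
    using q_fix
    by (intro metric_proj_eqI[symmetric]) (simp_all add: H_plus_eq inner_diff_right[of _ q])
  have proj_fix: "q = metric_proj (fix_set C T) u"
    if div: "filterlim (\<lambda>n. \<Sum>k=1..n. lam k) at_top sequentially"
  proof (rule metric_proj_eqI[symmetric, OF q_fix])
    fix z assume "z \<in> fix_set C T"
    \<comment> \<open>Divergence supplies on all of \<open>fix_set C T\<close> the inequality that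
      intersecting with \<open>H_plus\<close> imposed before.\<close>
    then have "2 * ((u - q) \<bullet> (q - z)) \<ge> 0"
      using halpern_quot_limit_nonneg[OF assms(5) x_C _ _ quot_lim div] lam by blast
    then show "(u - q) \<bullet> (q - z) \<ge> 0"
      by simp
  qed
  show ?thesis
    using quot_lim D proj_zero proj_plus proj_fix fix_cc by blast
qed

end
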